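(* Let $A$ be a residuated lattice and $(\mathcal{L}(A),\lambda)$ its reticulation. Then $A$ is a co-Stone residuated lattice if and only if $\mathcal{L}(A)$ is a co-Stone lattice.
   Context: A residuated lattice is an algebra $(A,\vee,\wedge,\odot,\rightarrow,0,1)$ such that $(A,\vee,\wedge,0,1)$ is a bounded lattice, $(A,\odot,1)$ is a commutative monoid, and $a\leq b\rightarrow c$ iff $a\odot b\leq c$ for all $a,b,c\in A$. Write $a^n$ for the $n$-fold $\odot$-product of $a$. A reticulation of $A$ is a pair $(\mathcal{L}(A),\lambda)$ with $\mathcal{L}(A)$ a bounded distributive lattice and $\lambda:A\to\mathcal{L}(A)$ a surjective function such that for all $a,b\in A$: $\lambda(a\odot b)=\lambda(a)\wedge\lambda(b)$; $\lambda(a\vee b)=\lambda(a)\vee\lambda(b)$; $\lambda(0)=0$, $\lambda(1)=1$; and $\lambda(a)\leq\lambda(b)$ iff $a^n\leq b$ for some integer $n\geq 1$. A reticulation exists and is unique up to isomorphism (compatible with $\lambda$). A filter of a lattice is a non-empty upward closed subset closed under $\wedge$; a filter of a residuated lattice is a non-empty upward closed subset closed under $\odot$. $\langle x\rangle$ is the filter generated by $x$. For $M$ a bounded distributive lattice or a residuated lattice, $B(M)$ is the Boolean algebra of complemented elements of $M$, and $x^{\top}=\{a\in M\mid a\vee x=1\}$ for $x\in M$. $M$ is co-Stone iff for all $x\in M$ there exists $e\in B(M)$ with $x^{\top}=\langle e\rangle$. *)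

theory Defs
  imports HOL.Hull
begin

unbundle lattice_syntax

text \<open>
  The constants 0 and 1 of a residuated lattice are \<^term>\<open>bot\<close> and \<^term>\<open>top\<close>; the library's
  multiplicative unit, and with it the library's power operator, is tied to \<^term>\<open>top\<close> by
  \<open>one_eq_top\<close>. The case 0 = 1 is not excluded.
\<close>

class residuated_lattice = bounded_lattice + comm_monoid_mult +
  fixes residuum :: "'a \<Rightarrow> 'a \<Rightarrow> 'a"
  assumes one_eq_top: "1 = \<top>"
    and residuation: "a \<le> residuum b c \<longleftrightarrow> a * b \<le> c"

definition reticulation ::
    "('a::residuated_lattice \<Rightarrow> 'l::{distrib_lattice, bounded_lattice}) \<Rightarrow> bool" where
  "reticulation lam \<longleftrightarrow>
     surj lam \<and>
     (\<forall>a b. lam (a * b) = lam a \<sqinter> lam b) \<and>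
     (\<forall>a b. lam (a \<squnion> b) = lam a \<squnion> lam b) \<and>
     lam \<bottom> = \<bottom> \<and> lam \<top> = \<top> \<and>
     (\<forall>a b. lam a \<le> lam b \<longleftrightarrow> (\<exists>n\<ge>1. a ^ n \<le> b))"

definition lattice_filter :: "'l::lattice set \<Rightarrow> bool" where
  "lattice_filter F \<longleftrightarrow>
     F \<noteq> {} \<and> (\<forall>x\<in>F. \<forall>y. x \<le> y \<longrightarrow> y \<in> F) \<and> (\<forall>x\<in>F. \<forall>y\<in>F. x \<sqinter> y \<in> F)"

definition residuated_filter :: "'a::residuated_lattice set \<Rightarrow> bool" where
  "residuated_filter F \<longleftrightarrow>
     F \<noteq> {} \<and> (\<forall>x\<in>F. \<forall>y. x \<le> y \<longrightarrow> y \<in> F) \<and> (\<forall>x\<in>F. \<forall>y\<in>F. x * y \<in> F)"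

definition complemented_elements :: "'m::bounded_lattice set" where
  "complemented_elements = {e. \<exists>f. e \<squnion> f = \<top> \<and> e \<sqinter> f = \<bottom>}"

definition co_annihilator :: "'m::bounded_lattice \<Rightarrow> 'm set" where
  "co_annihilator x = {a. a \<squnion> x = \<top>}"

text \<open>
  The two notions differ in the filters used: \<open>P hull {e}\<close> is the intersection of all sets
  satisfying \<open>P\<close> that contain \<open>e\<close>, i.e. the filter of the respective kind generated by \<open>e\<close>.
\<close>

definition co_Stone_lattice :: "'l::{distrib_lattice, bounded_lattice} itself \<Rightarrow> bool" where
  "co_Stone_lattice (_ :: 'l itself) \<longleftrightarrow>
     (\<forall>x::'l. \<exists>e\<in>complemented_elements. co_annihilator x = lattice_filter hull {e})"

definition co_Stone_residuated_lattice :: "'a::residuated_lattice itself \<Rightarrow> bool" where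
  "co_Stone_residuated_lattice (_ :: 'a itself) \<longleftrightarrow>
     (\<forall>x::'a. \<exists>e\<in>complemented_elements. co_annihilator x = residuated_filter hull {e})"

end

theory Submission
  imports Defs
begin

text \<open>
  Since \<open>lam a = \<top>\<close> only for \<open>a = \<top>\<close>, co-annihilators of \<open>x\<close> and \<open>lam x\<close> correspond under \<open>lam\<close>.
  Complemented elements \<open>e\<close> of a residuated lattice are idempotent, so the filters generated by \<open>e\<close>
  and \<open>lam e\<close> are the principal up-sets, and \<open>lam e \<le> lam a\<close> is the same as \<open>e \<le> a\<close>. Every
  complemented element of the reticulation is the image of a complemented element: if \<open>lam u\<close> and
  \<open>lam v\<close> are complementary, then \<open>(u * v) ^ n = \<bottom>\<close> for some \<open>n\<close>, and \<open>u ^ n\<close>, \<open>v ^ n\<close> are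
  complementary lifts.
\<close>

lemma mult_right_mono_residuated:
  fixes a b c :: "'a::residuated_lattice"
  assumes "a \<le> b"
  shows "a * c \<le> b * c"
  using assms by (meson order_refl order_trans residuation)

lemma mult_mono_residuated:
  fixes a b c d :: "'a::residuated_lattice"
  assumes "a \<le> b" "c \<le> d"
  shows "a * c \<le> b * d"
  using mult_right_mono_residuated[OF assms(1), of c] mult_right_mono_residuated[OF assms(2), of b]
  by (simp add: mult.commute)

lemma mult_le_left_residuated: "a * b \<le> (a::'a::residuated_lattice)"
  by (metis mult.right_neutral mult_mono_residuated one_eq_top order_refl top_greatest)

lemma mult_le_right_residuated: "a * b \<le> (b::'a::residuated_lattice)"
  using mult_le_left_residuated[of b a] by (simp add: mult.commute)

text \<open>Multiplication by \<open>c\<close> is left adjoint to \<open>residuum c\<close>, hence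
  preserves joins.\<close>

lemma sup_mult_distrib_residuated:
  fixes a b c :: "'a::residuated_lattice"
  shows "(a \<squnion> b) * c = a * c \<squnion> b * c"
proof (rule antisym)
  show "(a \<squnion> b) * c \<le> a * c \<squnion> b * c"
    by (metis le_sup_iff residuation sup_ge1 sup_ge2)
  show "a * c \<squnion> b * c \<le> (a \<squnion> b) * c"
    by (simp add: mult_right_mono_residuated)
qed

lemma complemented_mult_self:
  fixes e :: "'a::residuated_lattice"
  assumes "e \<in> complemented_elements"
  shows "e * e = e"
proof -
  obtain f where f: "e \<squnion> f = \<top>" "e \<sqinter> f = \<bottom>"
    using assms by (auto simp: complemented_elements_def)
  have "f * e \<le> e \<sqinter> f"
    by (simp add: mult_le_left_residuated mult_le_right_residuated)
  \<comment> \<open>Multiplying \<open>e \<squnion> f = \<top>\<close> by \<open>e\<close> now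
    leaves only the summand \<open>e * e\<close>.\<close>
  then have "f * e = \<bottom>"
    using f by (simp add: bot_unique)
  then have "e * e = (e \<squnion> f) * e"
    by (simp add: sup_mult_distrib_residuated)
  then show ?thesis
    using f by (simp flip: one_eq_top)
qed

lemma complemented_power:
  fixes e :: "'a::residuated_lattice"
  assumes "e \<in> complemented_elements" "n \<ge> 1"
  shows "e ^ n = e"
  using assms(2) by (induction n rule: dec_induct) (simp_all add: complemented_mult_self assms(1))

text \<open>A vanishing product is a priori weaker than a vanishing meet. Multiplying
  \<open>e \<sqinter> f\<close> by \<open>e \<squnion> f = \<top>\<close> splits it into two
  summands, each below \<open>e * f\<close>.\<close>

lemma complementedI_mult:
  fixes e f :: "'a::residuated_lattice"
  assumes "e \<squnion> f = \<top>" "e * f = \<bottom>"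
  shows "e \<in> complemented_elements"
proof -
  have "e \<sqinter> f = (e \<squnion> f) * (e \<sqinter> f)"
    using assms(1) by (simp flip: one_eq_top)
  also have "\<dots> = e * (e \<sqinter> f) \<squnion> f * (e \<sqinter> f)"
    by (rule sup_mult_distrib_residuated)
  also have "\<dots> \<le> e * f \<squnion> f * e"
    by (intro sup_mono mult_mono_residuated) auto
  finally have "e \<sqinter> f = \<bottom>"
    using assms(2) by (simp add: mult.commute bot_unique)
  then show ?thesis
    using assms(1) by (auto simp: complemented_elements_def)
qed

lemma lattice_filter_hull_singleton:
  fixes e :: "'l::lattice"
  shows "lattice_filter hull {e} = {e..}"
  by (rule hull_unique) (force simp: lattice_filter_def intro: le_infI order_trans)+

lemma residuated_filter_hull_complemented:
  fixes e :: "'a::residuated_lattice"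
  assumes "e \<in> complemented_elements"
  shows "residuated_filter hull {e} = {e..}"
proof (rule hull_unique)
  have "e \<le> x * y" if "e \<le> x" "e \<le> y" for x y
    using mult_mono_residuated[OF that] complemented_mult_self[OF assms] by simp
  then show "residuated_filter {e..}"
    by (auto simp: residuated_filter_def)
qed (auto simp: residuated_filter_def)

context
  fixes lam :: "'a::residuated_lattice \<Rightarrow> 'l::{distrib_lattice, bounded_lattice}"
  assumes ret: "reticulation lam"
begin

lemma reticulation_simps:
  shows reticulation_mult: "lam (a * b) = lam a \<sqinter> lam b"
    and reticulation_sup: "lam (a \<squnion> b) = lam a \<squnion> lam b"
    and reticulation_bot: "lam \<bottom> = \<bottom>"
    and reticulation_top: "lam \<top> = \<top>"
    and reticulation_le_iff: "lam a \<le> lam b \<longleftrightarrow> (\<exists>n\<ge>1. a ^ n \<le> b)"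
  using ret by (auto simp: reticulation_def)

lemma reticulation_surj: obtains a where "lam a = y"
  using ret by (metis reticulation_def surjD)

text \<open>All powers of \<open>\<top>\<close> equal \<open>\<top>\<close>, so
  \<open>lam \<top> \<le> lam a\<close> forces \<open>\<top> \<le> a\<close>.\<close>

lemma reticulation_eq_top_iff: "lam a = \<top> \<longleftrightarrow> a = \<top>"
proof
  assume "lam a = \<top>"
  then have "lam \<top> \<le> lam a"
    by simp
  then show "a = \<top>"
    unfolding reticulation_le_iff by (metis one_eq_top power_one top_unique)
qed (simp add: reticulation_top)

lemma reticulation_power:
  assumes "n \<ge> 1"
  shows "lam (a ^ n) = lam a"
  using assms by (induction n rule: dec_induct) (simp_all add: reticulation_mult)

text \<open>The definition of a reticulation controls \<open>lam\<close> on products rather than on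
  meets, so disjointness is passed on through \<open>e * f \<le> e \<sqinter> f\<close>.\<close>

lemma reticulation_complemented:
  assumes "e \<in> complemented_elements"
  shows "lam e \<in> complemented_elements"
proof -
  obtain f where f: "e \<squnion> f = \<top>" "e \<sqinter> f = \<bottom>"
    using assms by (auto simp: complemented_elements_def)
  have "e * f \<le> e \<sqinter> f"
    by (simp add: mult_le_left_residuated mult_le_right_residuated)
  then have "e * f = \<bottom>"
    using f by (simp add: bot_unique)
  then have "lam e \<sqinter> lam f = \<bottom>" "lam e \<squnion> lam f = \<top>"
    using f by (simp_all add: reticulation_bot reticulation_top
        flip: reticulation_mult reticulation_sup)
  then show ?thesis
    by (auto simp: complemented_elements_def)
qed

lemma reticulation_complemented_lift:
  assumes "l \<in> complemented_elements"
  obtains e where "e \<in> complemented_elements" "lam e = l"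
proof -
  obtain m where m: "l \<squnion> m = \<top>" "l \<sqinter> m = \<bottom>"
    using assms by (auto simp: complemented_elements_def)
  obtain u v where uv: "lam u = l" "lam v = m"
    by (metis reticulation_surj)
  have "lam (u * v) \<le> lam \<bottom>"
    using m uv by (simp add: reticulation_mult)
  then obtain n where n: "n \<ge> 1" "(u * v) ^ n \<le> \<bottom>"
    unfolding reticulation_le_iff by blast
  have "u ^ n * v ^ n = \<bottom>"
    using n by (simp add: power_mult_distrib bot_unique)
  \<comment> \<open>Taking powers does not change the images, so \<open>lam\<close> sends this join
    to \<open>l \<squnion> m = \<top>\<close>, and only \<open>\<top>\<close> is mapped to
    \<open>\<top>\<close>.\<close>
  moreover have "u ^ n \<squnion> v ^ n = \<top>"
    using m uv n(1) by (simp add: reticulation_sup reticulation_power flip: reticulation_eq_top_iff)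
  ultimately have "u ^ n \<in> complemented_elements"
    by (rule complementedI_mult[rotated])
  then show ?thesis
    using that reticulation_power[OF n(1)] uv(1) by blast
qed

text \<open>The exponent in the order criterion disappears because \<open>e ^ n = e\<close> for
  \<open>n \<ge> 1\<close>.\<close>

lemma reticulation_complemented_le_iff:
  assumes "e \<in> complemented_elements"
  shows "lam e \<le> lam a \<longleftrightarrow> e \<le> a"
  using complemented_power[OF assms] by (auto simp: reticulation_le_iff)

lemma reticulation_co_annihilator_iff:
  "lam a \<in> co_annihilator (lam x) \<longleftrightarrow> a \<in> co_annihilator x"
  by (simp add: co_annihilator_def reticulation_eq_top_iff flip: reticulation_sup)

lemma reticulation_co_annihilator_eq_hull_iff:
  assumes "e \<in> complemented_elements"
  shows "co_annihilator (lam x) = lattice_filter hull {lam e}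
    \<longleftrightarrow> co_annihilator x = residuated_filter hull {e}"
proof -
  \<comment> \<open>By surjectivity, two subsets of the reticulation are equal once they contain the
    same images \<open>lam a\<close>.\<close>
  have "co_annihilator (lam x) = {lam e..}
      \<longleftrightarrow> (\<forall>a. lam a \<in> co_annihilator (lam x) \<longleftrightarrow> lam a \<in> {lam e..})"
    by (metis reticulation_surj set_eqI)
  also have "\<dots> \<longleftrightarrow> co_annihilator x = {e..}"
    using assms
    by (auto simp: reticulation_co_annihilator_iff reticulation_complemented_le_iff)
  finally show ?thesis
    using assms by (simp add: lattice_filter_hull_singleton residuated_filter_hull_complemented)
qed

end

theorem proposition3p5:
  fixes lam :: "'a::residuated_lattice \<Rightarrow> 'l::{distrib_lattice, bounded_lattice}"
  assumes "reticulation lam"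
  shows "co_Stone_residuated_lattice TYPE('a) \<longleftrightarrow> co_Stone_lattice TYPE('l)"
  unfolding co_Stone_residuated_lattice_def co_Stone_lattice_def
  \<comment> \<open>From left to right, an element of the reticulation is written as
    \<open>lam x\<close> and the generator \<open>e\<close> for \<open>x\<close> is mapped to
    \<open>lam e\<close>; from right to left, the generator for \<open>lam x\<close> is
    lifted.\<close>
  by (metis reticulation_co_annihilator_eq_hull_iff[OF assms] reticulation_surj[OF assms]
      reticulation_complemented[OF assms] reticulation_complemented_lift[OF assms])

end
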